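(* The following statements hold for the fully discrete solution matrices $\mathcal{E}_{n,\tau}$ (inequalities elementwise). (i) If $\mathcal{H}^{-1}>0$, then there exists a $\tau_0>0$ such that $\mathcal{E}_{n,\tau}\ge0$ for all $\tau\ge\tau_0$ and $n\ge1$. (ii) If $\mathcal{E}_{1,\tau_0}\ge0$ for some $\tau_0>0$, then $\mathcal{E}_{n,\tau}\ge0$ for all $\tau\ge\tau_0$ and $n\ge1$, and $\mathcal{H}^{-1}\ge0$.
   Context: Characteristic function. One of two cases is assumed. Case I: $P(z)=\sum_{i=1}^m b_iz^{\alpha_i}$, $m\ge1$, $0<\alpha_m<\dots<\alpha_1<1$, $b_i>0$, $b_1=1$. Case II: $P(z)=\int_0^1z^\alpha\mu(\alpha)\,d\alpha$, with $\mu\ge0$ Hölder continuous on $[0,1]$ and $\mu(0)\mu(1)>0$. Finite elements. $\Omega\subset\mathbb{R}^2$ is a bounded polygonal domain, $\mathcal{T}_h$ a (conforming) triangulation of $\Omega$, $X_h\subset H_0^1(\Omega)$ the space of continuous functions that are linear on each triangle of $\mathcal{T}_h$ and vanish on $\partial\Omega$. $P_1,\dots,P_N$ are the interior nodes and $\phi_1,\dots,\phi_N$ the corresponding nodal basis. The stiffness matrix is $\mathcal{S}=(s_{ij})$, $s_{ij}=\int_\Omega\nabla\phi_j\cdot\nabla\phi_i\,dx$; the mass matrix is $\mathcal{M}=(m_{ij})$, $m_{ij}=[\phi_j,\phi_i]$, where $[\cdot,\cdot]$ is an inner product on $X_h$ (approximating the $L^2$ inner product). Both matrices are symmetric positive definite,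 $\mathcal{H}=\mathcal{M}^{-1}\mathcal{S}$, and $\mathcal{I}$ is the identity matrix. Fully discrete scheme. For a time step $\tau>0$ the weights $\omega_j=\omega_j(\tau)$ are defined by $\sum_{j=0}^\infty\omega_j\xi^j=P((1-\xi)/\tau)$, so $\omega_0=P(\tau^{-1})$. The solution matrices $\mathcal{E}_{n,\tau}$ are defined by $U^n=\mathcal{E}_{n,\tau}V$, where $U^0=V$ and, for $n\ge1$, $$U^n=(\omega_0\mathcal{I}+\mathcal{H})^{-1}\Big(\sum_{j=0}^{n-1}\omega_jV-\sum_{j=1}^{n-1}\omega_{n-j}U^j\Big).$$ In particular $\mathcal{E}_{1,\tau}=\omega_0(\omega_0\mathcal{I}+\mathcal{H})^{-1}$. *)

theory Defs
  imports "HOL-Analysis.Analysis"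
begin

section \<open>Characteristic functions\<close>

text \<open>Only the values at positive arguments matter, and \<open>z powr \<alpha>\<close> is the intended power there.\<close>

definition multi_term_char_fun :: "(real \<Rightarrow> real) \<Rightarrow> bool" where
  "multi_term_char_fun P \<longleftrightarrow>
     (\<exists>(m::nat) (\<alpha>::nat \<Rightarrow> real) (b::nat \<Rightarrow> real).
        1 \<le> m \<and> 0 < \<alpha> m \<and> (\<forall>i. 1 \<le> i \<and> i < m \<longrightarrow> \<alpha> (Suc i) < \<alpha> i) \<and> \<alpha> 1 < 1 \<and>
        (\<forall>i\<in>{1..m}. 0 < b i) \<and> b 1 = 1 \<and>
        (\<forall>z>0. P z = (\<Sum>i=1..m. b i * z powr \<alpha> i)))"

definition hoelder_continuous_on :: "real set \<Rightarrow> (real \<Rightarrow> real) \<Rightarrow> bool" where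
  "hoelder_continuous_on S f \<longleftrightarrow>
     (\<exists>C \<gamma>. 0 < \<gamma> \<and> \<gamma> \<le> 1 \<and> (\<forall>x\<in>S. \<forall>y\<in>S. \<bar>f x - f y\<bar> \<le> C * \<bar>x - y\<bar> powr \<gamma>))"

definition distributed_char_fun :: "(real \<Rightarrow> real) \<Rightarrow> bool" where
  "distributed_char_fun P \<longleftrightarrow>
     (\<exists>\<mu>::real \<Rightarrow> real.
        (\<forall>\<alpha>\<in>{0..1}. 0 \<le> \<mu> \<alpha>) \<and> hoelder_continuous_on {0..1} \<mu> \<and> 0 < \<mu> 0 * \<mu> 1 \<and>
        (\<forall>z>0. P z = integral {0..1} (\<lambda>\<alpha>. z powr \<alpha> * \<mu> \<alpha>)))"


section \<open>Piecewise linear finite elements\<close>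

text \<open>Multiply connected domains and domains with cracks are allowed.\<close>

definition bounded_polygonal_domain :: "(real^2) set \<Rightarrow> bool" where
  "bounded_polygonal_domain \<Omega> \<longleftrightarrow>
     \<Omega> \<noteq> {} \<and> open \<Omega> \<and> connected \<Omega> \<and> bounded \<Omega> \<and>
     (\<exists>S. finite S \<and> (\<forall>(a, b)\<in>S. a \<noteq> b) \<and> frontier \<Omega> = (\<Union>(a, b)\<in>S. closed_segment a b))"

text \<open>The library predicate \<^const>\<open>triangulation\<close> expresses conformity: two members meet in a common
  face. The last condition says that the mesh resolves the boundary. It only has content for
  domains with cracks, since otherwise \<open>\<Omega>\<close> is the interior of its closure.\<close>

definition triangulation_of :: "(real^2) set \<Rightarrow> (real^2) set set \<Rightarrow> bool" where
  "triangulation_of \<Omega> \<T> \<longleftrightarrow>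
     triangulation \<T> \<and> (\<forall>K\<in>\<T>. 2 simplex K) \<and> \<Union>\<T> = closure \<Omega> \<and>
     (\<exists>\<E>. (\<forall>e\<in>\<E>. \<exists>K\<in>\<T>. e edge_of K) \<and> frontier \<Omega> = \<Union>\<E>)"

definition interior_nodes :: "(real^2) set \<Rightarrow> (real^2) set set \<Rightarrow> (real^2) set" where
  "interior_nodes \<Omega> \<T> = {p \<in> \<Omega>. \<exists>K\<in>\<T>. p extreme_point_of K}"

text \<open>The space \<open>X\<^sub>h\<close>. Its members are extended by zero outside \<open>\<Omega>\<close>, so that equality in \<open>X\<^sub>h\<close> is
  equality of functions; vanishing on the frontier is included, as \<open>\<Omega>\<close> is open.\<close>

definition fe_space :: "(real^2) set \<Rightarrow> (real^2) set set \<Rightarrow> (real^2 \<Rightarrow> real) set" where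
  "fe_space \<Omega> \<T> =
     {v. continuous_on (closure \<Omega>) v \<and>
         (\<forall>K\<in>\<T>. \<exists>a c. \<forall>x\<in>K. v x = a \<bullet> x + c) \<and>
         (\<forall>x. x \<notin> \<Omega> \<longrightarrow> v x = 0)}"

definition nodal_basis ::
  "(real^2) set \<Rightarrow> (real^2) set set \<Rightarrow> ('n \<Rightarrow> real^2) \<Rightarrow> ('n \<Rightarrow> real^2 \<Rightarrow> real) \<Rightarrow> bool" where
  "nodal_basis \<Omega> \<T> p \<phi> \<longleftrightarrow>
     (\<forall>i. \<phi> i \<in> fe_space \<Omega> \<T> \<and> (\<forall>j. \<phi> i (p j) = (if i = j then 1 else 0)))"

definition inner_product_on ::
  "('a \<Rightarrow> real) set \<Rightarrow> (('a \<Rightarrow> real) \<Rightarrow> ('a \<Rightarrow> real) \<Rightarrow> real) \<Rightarrow> bool" where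
  "inner_product_on X ip \<longleftrightarrow>
     (\<forall>u\<in>X. \<forall>v\<in>X. ip u v = ip v u) \<and>
     (\<forall>u\<in>X. \<forall>v\<in>X. \<forall>w\<in>X. ip (\<lambda>x. u x + v x) w = ip u w + ip v w) \<and>
     (\<forall>c. \<forall>u\<in>X. \<forall>v\<in>X. ip (\<lambda>x. c * u x) v = c * ip u v) \<and>
     (\<forall>u\<in>X. u \<noteq> (\<lambda>x. 0) \<longrightarrow> 0 < ip u u)"

text \<open>The value of \<open>grad\<close> is unspecified where \<open>f\<close> is not differentiable. For members of
  \<^const>\<open>fe_space\<close> this concerns only points on the edges of the mesh, a null set, and the
  integral below is over the complete measure \<^const>\<open>lebesgue\<close>.\<close>

definition grad :: "(real^2 \<Rightarrow> real) \<Rightarrow> real^2 \<Rightarrow> real^2" where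
  "grad f x = (THE D. GDERIV f x :> D)"

definition stiffness_matrix :: "(real^2) set \<Rightarrow> ('n::finite \<Rightarrow> real^2 \<Rightarrow> real) \<Rightarrow> real^'n^'n" where
  "stiffness_matrix \<Omega> \<phi> = (\<chi> i j. LINT x:\<Omega>|lebesgue. grad (\<phi> j) x \<bullet> grad (\<phi> i) x)"

definition mass_matrix ::
  "((real^2 \<Rightarrow> real) \<Rightarrow> (real^2 \<Rightarrow> real) \<Rightarrow> real) \<Rightarrow> ('n::finite \<Rightarrow> real^2 \<Rightarrow> real) \<Rightarrow> real^'n^'n" where
  "mass_matrix ip \<phi> = (\<chi> i j. ip (\<phi> j) (\<phi> i))"

definition fe_operator ::
  "(real^2) set \<Rightarrow> ((real^2 \<Rightarrow> real) \<Rightarrow> (real^2 \<Rightarrow> real) \<Rightarrow> real) \<Rightarrow>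
   ('n::finite \<Rightarrow> real^2 \<Rightarrow> real) \<Rightarrow> real^'n^'n" where
  "fe_operator \<Omega> ip \<phi> = matrix_inv (mass_matrix ip \<phi>) ** stiffness_matrix \<Omega> \<phi>"


section \<open>The fully discrete scheme\<close>

text \<open>For \<open>\<bar>\<xi>\<bar> < 1\<close> and \<open>\<tau> > 0\<close> the argument \<open>(1 - \<xi>) / \<tau>\<close> is positive.\<close>

definition weights :: "(real \<Rightarrow> real) \<Rightarrow> real \<Rightarrow> nat \<Rightarrow> real" where
  "weights P \<tau> = (THE w. \<forall>\<xi>. \<bar>\<xi>\<bar> < 1 \<longrightarrow> (\<lambda>j. w j * \<xi> ^ j) sums P ((1 - \<xi>) / \<tau>))"

fun discrete_solution :: "real^'n^'n \<Rightarrow> (nat \<Rightarrow> real) \<Rightarrow> real^'n \<Rightarrow> nat \<Rightarrow> real^'n" where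
  "discrete_solution H w V n =
     (if n = 0 then V
      else matrix_inv (w 0 *\<^sub>R mat 1 + H) *v
             ((\<Sum>j=0..n-1. w j *\<^sub>R V) - (\<Sum>j=1..n-1. w (n - j) *\<^sub>R discrete_solution H w V j)))"

declare discrete_solution.simps [simp del]

definition solution_matrix :: "(real \<Rightarrow> real) \<Rightarrow> real^'n^'n \<Rightarrow> nat \<Rightarrow> real \<Rightarrow> real^'n^'n" where
  "solution_matrix P H n \<tau> = matrix (\<lambda>V. discrete_solution H (weights P \<tau>) V n)"

lemma linear_discrete_solution: "linear (\<lambda>V. discrete_solution H w V n)"
proof (induction n rule: less_induct)
  case (less n)
  show ?case
  proof (cases "n = 0")
    case True
    then show ?thesis
      by (simp add: discrete_solution.simps linear_iff)
  next
    case False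
    have "linear (\<lambda>V. \<Sum>j=1..n-1. w (n - j) *\<^sub>R discrete_solution H w V j)"
      using False by (intro linear_compose_sum ballI linear_compose_scale_right less.IH) auto
    moreover have "linear (\<lambda>V. \<Sum>j=0..n-1. w j *\<^sub>R V)"
      by (intro linear_compose_sum ballI linear_compose_scale_right linear_ident)
    ultimately have lin: "linear (\<lambda>V. (\<Sum>j=0..n-1. w j *\<^sub>R V)
        - (\<Sum>j=1..n-1. w (n - j) *\<^sub>R discrete_solution H w V j))"
      by (rule linear_compose_sub[rotated])
    have "(\<lambda>V. discrete_solution H w V n) =
        (*v) (matrix_inv (w 0 *\<^sub>R mat 1 + H)) \<circ> (\<lambda>V. (\<Sum>j=0..n-1. w j *\<^sub>R V)
          - (\<Sum>j=1..n-1. w (n - j) *\<^sub>R discrete_solution H w V j))"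
      using False by (subst discrete_solution.simps) (simp add: fun_eq_iff)
    then show ?thesis
      using linear_compose[OF lin matrix_vector_mul_linear] by simp
  qed
qed

lemma solution_matrix_works: "solution_matrix P H n \<tau> *v V = discrete_solution H (weights P \<tau>) V n"
  unfolding solution_matrix_def
  by (rule fun_cong[OF matrix_vector_mul(2)[OF linear_discrete_solution]])

lemma solution_matrix_1:
  "solution_matrix P H 1 \<tau> = weights P \<tau> 0 *\<^sub>R matrix_inv (weights P \<tau> 0 *\<^sub>R mat 1 + H)"
proof -
  have "solution_matrix P H 1 \<tau> *v V =
      (weights P \<tau> 0 *\<^sub>R matrix_inv (weights P \<tau> 0 *\<^sub>R mat 1 + H)) *v V" for V
    by (simp add: solution_matrix_works discrete_solution.simps matrix_vector_mult_scaleR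
        scaleR_matrix_vector_assoc)
  then show ?thesis
    by (simp add: matrix_eq)
qed

definition nonneg_matrix :: "real^'n^'n \<Rightarrow> bool" where
  "nonneg_matrix A \<longleftrightarrow> (\<forall>i j. 0 \<le> A $ i $ j)"

definition pos_matrix :: "real^'n^'n \<Rightarrow> bool" where
  "pos_matrix A \<longleftrightarrow> (\<forall>i j. 0 < A $ i $ j)"

end

theory Submission
  imports Defs
begin

text \<open>Since \<open>\<M>\<close> and \<open>\<S>\<close> are positive definite, \<open>(\<omega>\<I> + \<H>)\<^sup>-\<^sup>1\<close> exists and is bounded by a
  constant \<open>K\<close> uniformly in \<open>\<omega> \<ge> 0\<close>. If it is nonnegative for some \<open>\<omega>\<close>, then it is nonnegative for
  every \<open>\<omega>' \<in> [0, \<omega>]\<close>: the negative part \<open>y\<close> of a solution for \<open>\<omega>'\<close> with nonnegative data satisfies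
  \<open>0 \<le> y \<le> (\<omega> - \<omega>')(\<omega>\<I> + \<H>)\<^sup>-\<^sup>1 y\<close>, which forces \<open>y = 0\<close> when \<open>(\<omega> - \<omega>') K < 1\<close>, and finitely many
  such steps reach any \<open>\<omega>'\<close>. The value \<open>\<omega>\<^sub>0(\<tau>) = P(1/\<tau>)\<close> decreases to zero as \<open>\<tau>\<close> grows, and because
  \<open>\<omega>\<^sub>j \<le> 0\<close> for \<open>j \<ge> 1\<close> while the partial sums of the weights are nonnegative, the time stepping
  scheme combines previous values with nonnegative coefficients only.\<close>

section \<open>Resolvents with a uniform bound\<close>

text \<open>Phrased as an a priori estimate rather than as a bound on an inverse, so that it yields
  the injectivity of \<omega>I + A and the norm bound of its inverse at once. \<open>K\<close> must
  not depend on \<omega>, because the step length of the later descent in \<omega> is derived from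
  it.\<close>

definition resolvent_bound :: "real^'n^'n \<Rightarrow> real \<Rightarrow> bool" where
  "resolvent_bound A K \<longleftrightarrow> 0 < K \<and> (\<forall>\<omega>\<ge>0. \<forall>x. norm x \<le> K * norm (\<omega> *\<^sub>R x + A *v x))"

lemma matrix_inv_left_right:
  fixes A :: "real^'n^'n"
  assumes "invertible A"
  shows "A ** matrix_inv A = mat 1" "matrix_inv A ** A = mat 1"
  using someI_ex[OF assms[unfolded invertible_def]] unfolding matrix_inv_def by auto

lemma invertible_if_injective:
  fixes A :: "real^'n^'n"
  assumes "\<And>x. A *v x = 0 \<Longrightarrow> x = 0"
  shows "invertible A"
  unfolding invertible_left_inverse matrix_left_invertible_ker using assms by simp

text \<open>The quadratic form attains a positive minimum on the compact unit sphere; scaling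
  carries it to all vectors.\<close>

lemma pos_def_coercive:
  fixes A :: "real^'n^'n"
  assumes "\<And>x. x \<noteq> 0 \<Longrightarrow> 0 < x \<bullet> (A *v x)"
  obtains c where "0 < c" "\<And>x. c * (norm x)\<^sup>2 \<le> x \<bullet> (A *v x)"
proof -
  have cont: "continuous_on (sphere 0 1) (\<lambda>x. x \<bullet> (A *v x))"
    by (intro continuous_intros)
  have "sphere (0::real^'n) 1 \<noteq> {}"
    by simp
  from continuous_attains_inf[OF compact_sphere this cont]
  obtain u where u: "u \<in> sphere 0 1"
    and min: "\<And>y. y \<in> sphere 0 1 \<Longrightarrow> u \<bullet> (A *v u) \<le> y \<bullet> (A *v y)"
    by blast
  show thesis
  proof
    show "0 < u \<bullet> (A *v u)"
      using u by (intro assms) auto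
    show "u \<bullet> (A *v u) * (norm x)\<^sup>2 \<le> x \<bullet> (A *v x)" for x
    proof (cases "x = 0")
      case False
      have "u \<bullet> (A *v u) \<le> (x /\<^sub>R norm x) \<bullet> (A *v (x /\<^sub>R norm x))"
        using False by (intro min) simp
      also have "\<dots> = (x \<bullet> (A *v x)) / (norm x)\<^sup>2"
        by (simp add: matrix_vector_mult_scaleR field_simps power2_eq_square)
      finally show ?thesis
        using False by (simp add: field_simps)
    qed simp
  qed
qed

text \<open>Multiplying y = \<omega>x + Hx by M and testing with x gives c|x|^2 <= \<omega> x.Mx +
  x.Sx = x.My <= B|x||y|. The \<omega> term is nonnegative and only dropped, so the constant B/c is
  uniform in \<omega>.\<close>

lemma resolvent_bound_pos_def:
  fixes M S :: "real^'n^'n"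
  assumes M: "\<And>x. x \<noteq> 0 \<Longrightarrow> 0 < x \<bullet> (M *v x)"
    and S: "\<And>x. x \<noteq> 0 \<Longrightarrow> 0 < x \<bullet> (S *v x)"
  shows "\<exists>K. resolvent_bound (matrix_inv M ** S) K"
proof -
  have "invertible M"
    using M by (intro invertible_if_injective) force
  obtain c where c: "0 < c" "\<And>x. c * (norm x)\<^sup>2 \<le> x \<bullet> (S *v x)"
    using pos_def_coercive[OF S] by blast
  obtain B where B: "0 < B" "\<And>x. norm (M *v x) \<le> norm x * B"
    using bounded_linear.pos_bounded[OF matrix_vector_mul_bounded_linear[of M]] by blast
  have "norm x \<le> (B / c) * norm (\<omega> *\<^sub>R x + (matrix_inv M ** S) *v x)" if "0 \<le> \<omega>" for \<omega> x
  proof (cases "x = 0")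
    case False
    define y where "y = \<omega> *\<^sub>R x + (matrix_inv M ** S) *v x"
    have "M *v y = \<omega> *\<^sub>R (M *v x) + S *v x"
      by (simp add: y_def matrix_vector_right_distrib matrix_vector_mult_scaleR
          matrix_vector_mul_assoc matrix_mul_assoc matrix_inv_left_right[OF \<open>invertible M\<close>])
    have "c * (norm x)\<^sup>2 \<le> \<omega> * (x \<bullet> (M *v x)) + x \<bullet> (S *v x)"
      using c(2)[of x] M[OF False] that by (simp add: add_increasing)
    also have "\<dots> = x \<bullet> (M *v y)"
      using \<open>M *v y = _\<close> by (simp add: inner_add_right)
    also have "\<dots> \<le> norm x * norm (M *v y)"
      by (rule norm_cauchy_schwarz)
    also have "\<dots> \<le> norm x * (norm y * B)"
      by (intro mult_left_mono B norm_ge_zero)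
    finally have "c * norm x \<le> norm y * B"
      using False by (simp add: power2_eq_square)
    then show ?thesis
      using \<open>0 < c\<close> by (simp add: y_def[symmetric] field_simps)
  qed simp
  then show ?thesis
    unfolding resolvent_bound_def using B(1) c(1) by (intro exI[of _ "B / c"]) auto
qed

section \<open>Resolvents and the resolvent identity\<close>

text \<open>\<open>matrix_inv\<close> is meaningful only for invertible matrices;
  \<open>resolvent_bound\<close> ensures this for all \<omega> >= 0, including \<omega> = 0, where
  the resolvent is the inverse of \<open>A\<close>.\<close>

definition resolvent :: "real^'n^'n \<Rightarrow> real \<Rightarrow> real^'n^'n" where
  "resolvent A \<omega> = matrix_inv (\<omega> *\<^sub>R mat 1 + A)"

lemma shifted_matrix_vector_mult:
  fixes A :: "real^'n^'n"
  shows "(\<omega> *\<^sub>R mat 1 + A) *v x = \<omega> *\<^sub>R x + A *v x"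
  by (simp add: matrix_vector_mult_add_rdistrib scaleR_matrix_vector_assoc[symmetric])

text \<open>The bound makes the kernel of \<omega>I + A trivial, hence the matrix invertible. Later
  arguments can thus use the equation that the resolvent solves.\<close>

lemma resolvent_eq_iff:
  assumes "resolvent_bound A K" "0 \<le> \<omega>"
  shows "resolvent A \<omega> *v b = x \<longleftrightarrow> \<omega> *\<^sub>R x + A *v x = b"
proof -
  let ?B = "\<omega> *\<^sub>R mat 1 + A"
  have inv: "invertible ?B"
  proof (rule invertible_if_injective)
    fix x assume "?B *v x = 0"
    then have "norm x \<le> K * norm (0 :: real^'a)"
      using assms unfolding resolvent_bound_def shifted_matrix_vector_mult by metis
    then show "x = 0" by simp
  qed
  have "resolvent A \<omega> *v b = x \<longleftrightarrow> ?B *v x = b"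
    unfolding resolvent_def using matrix_inv_left_right[OF inv]
    by (metis matrix_vector_mul_assoc matrix_vector_mul_lid)
  then show ?thesis
    by (simp add: shifted_matrix_vector_mult)
qed

lemma norm_resolvent_le:
  assumes "resolvent_bound A K" "0 \<le> \<omega>"
  shows "norm (resolvent A \<omega> *v b) \<le> K * norm b"
  using resolvent_eq_iff[OF assms, of b "resolvent A \<omega> *v b"] assms
  unfolding resolvent_bound_def by metis

text \<open>The resolvent identity R(\<omega>') = R(\<omega>) + (\<omega> - \<omega>') R(\<omega>)
  R(\<omega>'), applied to a vector: passing from the shift \<omega>' to \<omega> adds (\<omega> -
  \<omega>') x to the right-hand side.\<close>

lemma resolvent_shift:
  assumes "resolvent_bound A K" "0 \<le> \<omega>" "0 \<le> \<omega>'"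
  shows "resolvent A \<omega>' *v b =
    resolvent A \<omega> *v b + (\<omega> - \<omega>') *\<^sub>R (resolvent A \<omega> *v (resolvent A \<omega>' *v b))"
proof -
  define x where "x = resolvent A \<omega>' *v b"
  have "\<omega>' *\<^sub>R x + A *v x = b"
    using resolvent_eq_iff[OF assms(1,3)] x_def by blast
  then have "\<omega> *\<^sub>R x + A *v x = b + (\<omega> - \<omega>') *\<^sub>R x"
    by (auto simp: algebra_simps)
  then have "resolvent A \<omega> *v (b + (\<omega> - \<omega>') *\<^sub>R x) = x"
    using resolvent_eq_iff[OF assms(1,2)] by blast
  then show ?thesis
    by (simp add: x_def[symmetric] matrix_vector_right_distrib matrix_vector_mult_scaleR)
qed

section \<open>Nonnegativity of resolvents\<close>

lemma nonneg_matrix_mult_nonneg: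
  assumes "nonneg_matrix A" "\<And>i. 0 \<le> b $ i"
  shows "0 \<le> (A *v b) $ i"
  using assms by (auto simp: nonneg_matrix_def matrix_vector_mult_def intro!: sum_nonneg)

lemma nonneg_matrix_iff_axis: "nonneg_matrix A \<longleftrightarrow> (\<forall>i j. 0 \<le> (A *v axis j 1) $ i)"
  by (simp add: nonneg_matrix_def matrix_vector_mult_basis column_def)

lemma nonneg_resolvent_step:
  assumes bound: "resolvent_bound A K" and nonneg: "nonneg_matrix (resolvent A \<omega>)"
    and le: "0 \<le> \<omega>'" "\<omega>' \<le> \<omega>" and small: "(\<omega> - \<omega>') * K < 1"
  shows "nonneg_matrix (resolvent A \<omega>')"
proof -
  have "0 \<le> (resolvent A \<omega>' *v b) $ i" if b: "\<And>i. 0 \<le> b $ i" for b i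
  proof -
    define x where "x = resolvent A \<omega>' *v b"
    define y :: "real^'a" where "y = (\<chi> i. max 0 (- x $ i))"
    define z where "z = (\<omega> - \<omega>') *\<^sub>R (resolvent A \<omega> *v y)"
    have y: "0 \<le> y $ j" "0 \<le> x $ j + y $ j" for j
      by (auto simp: y_def)
    have x: "x = resolvent A \<omega> *v b + (\<omega> - \<omega>') *\<^sub>R (resolvent A \<omega> *v x)"
      unfolding x_def using bound le by (intro resolvent_shift) auto
    have "0 \<le> z $ j \<and> y $ j \<le> z $ j" for j
    proof -
      \<comment> \<open>Adding \<open>z\<close> to the fixed-point equation for \<open>x\<close>
        turns R(\<omega>) x into R(\<omega>)(x + y), where x + y is the positive part of
        \<open>x\<close>. Everything on the right is now nonnegative, so \<open>z\<close> dominates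
        the negative part \<open>y\<close>.\<close>
      have "x + z = resolvent A \<omega> *v b + (\<omega> - \<omega>') *\<^sub>R (resolvent A \<omega> *v (x + y))"
        by (subst x) (simp add: z_def matrix_vector_right_distrib algebra_simps)
      then have "(x + z) $ j = (resolvent A \<omega> *v b) $ j
          + (\<omega> - \<omega>') * (resolvent A \<omega> *v (x + y)) $ j"
        by simp
      moreover have "0 \<le> (resolvent A \<omega> *v b) $ j" "0 \<le> (resolvent A \<omega> *v (x + y)) $ j"
        using nonneg b y by (auto intro!: nonneg_matrix_mult_nonneg)
      ultimately have "0 \<le> x $ j + z $ j"
        using le by simp
      moreover have "0 \<le> z $ j"
        using nonneg y le by (auto simp: z_def intro!: mult_nonneg_nonneg nonneg_matrix_mult_nonneg)
      ultimately show ?thesis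
        by (simp add: y_def)
    qed
    then have "norm y \<le> norm z"
      using y by (intro norm_le_componentwise_cart) (auto simp: abs_of_nonneg)
    also have "\<dots> \<le> (\<omega> - \<omega>') * (K * norm y)"
      unfolding z_def using le bound by (auto intro!: mult_left_mono norm_resolvent_le)
    finally have "norm y * (1 - (\<omega> - \<omega>') * K) \<le> 0"
      by (simp add: algebra_simps)
    then have "y = 0"
      using small by (auto simp: mult_le_0_iff)
    then show ?thesis
      using y(2)[of i] by (simp add: x_def)
  qed
  then show ?thesis
    by (simp add: nonneg_matrix_iff_axis axis_def)
qed

lemma nonneg_resolvent_antimono:
  assumes bound: "resolvent_bound A K" and nonneg: "nonneg_matrix (resolvent A \<omega>)"
    and le: "0 \<le> \<omega>'" "\<omega>' \<le> \<omega>"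
  shows "nonneg_matrix (resolvent A \<omega>')"
proof -
  \<comment> \<open>Half of the critical step length 1/K.\<close>
  define d where "d = 1 / (2 * K)"
  have K: "0 < K"
    using bound by (simp add: resolvent_bound_def)
  then have d: "0 < d" "d * K < 1"
    by (auto simp: d_def)
  \<comment> \<open>Induction on the number of steps of length \<open>d\<close>. The intermediate
    shift is capped at \<omega>, beyond which nothing is known.\<close>
  have "nonneg_matrix (resolvent A \<omega>')" if "0 \<le> \<omega>'" "\<omega>' \<le> \<omega>" "\<omega> - \<omega>' \<le> real n * d" for n \<omega>'
    using that
  proof (induction n arbitrary: \<omega>')
    case 0
    then show ?case using nonneg by simp
  next
    case (Suc n)
    have "nonneg_matrix (resolvent A (min \<omega> (\<omega>' + d)))"
      using Suc.prems d by (intro Suc.IH) (auto simp: algebra_simps min_def)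
    moreover have "(min \<omega> (\<omega>' + d) - \<omega>') * K \<le> d * K"
      using K by (intro mult_right_mono) auto
    then have "(min \<omega> (\<omega>' + d) - \<omega>') * K < 1"
      using d by linarith
    ultimately show ?case
      using nonneg_resolvent_step[OF bound, of "min \<omega> (\<omega>' + d)" \<omega>'] Suc.prems d by simp
  qed
  moreover obtain n where "\<omega> - \<omega>' < real n * d"
    using ex_less_of_nat_mult[OF d(1)] by blast
  ultimately show ?thesis
    using le by (meson less_imp_le)
qed

text \<open>Write R(\<omega>) = R(0) - \<omega> R(0) R(\<omega>). The entries of R(0) R(\<omega>)
  are at most K^2, so for small \<omega> the correction cannot exceed the smallest entry of
  R(0).\<close>

lemma nonneg_resolvent_near_0:
  assumes bound: "resolvent_bound A K" and pos: "pos_matrix (resolvent A 0)"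
  obtains \<omega> where "0 < \<omega>" "nonneg_matrix (resolvent A \<omega>)"
proof -
  define m where "m = Min (range (\<lambda>(i, j). resolvent A 0 $ i $ j))"
  have "0 < m"
    using pos by (auto simp: m_def pos_matrix_def)
  have m: "m \<le> resolvent A 0 $ i $ j" for i j
    unfolding m_def by (rule Min_le) auto
  have K: "0 < K"
    using bound by (simp add: resolvent_bound_def)
  \<comment> \<open>Makes the bound \<omega> K^2 on the correction equal to the smallest entry
    \<open>m\<close>, just enough for nonnegativity.\<close>
  define \<omega> where "\<omega> = m / K\<^sup>2"
  have \<omega>: "0 < \<omega>" "\<omega> * K\<^sup>2 = m"
    using K \<open>0 < m\<close> by (auto simp: \<omega>_def)
  have "0 \<le> (resolvent A \<omega> *v axis j 1) $ i" for i j
  proof -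
    let ?e = "axis j 1 :: real^'a"
    let ?v = "resolvent A 0 *v (resolvent A \<omega> *v ?e)"
    have "resolvent A \<omega> *v ?e = resolvent A 0 *v ?e + (0 - \<omega>) *\<^sub>R ?v"
      using bound \<omega> by (intro resolvent_shift) auto
    from arg_cong[OF this, of "\<lambda>v. v $ i"]
    have "(resolvent A \<omega> *v ?e) $ i = (resolvent A 0 *v ?e) $ i - \<omega> * ?v $ i"
      by (simp only: vector_add_component vector_scaleR_component) simp
    then have "(resolvent A \<omega> *v ?e) $ i = resolvent A 0 $ i $ j - \<omega> * ?v $ i"
      by (simp only: matrix_vector_mult_basis column_def vec_lambda_beta)
    moreover have "?v $ i \<le> K * (K * norm ?e)"
    proof -
      have "?v $ i \<le> norm ?v"
        using component_le_norm_cart[of ?v i] by linarith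
      also have "\<dots> \<le> K * norm (resolvent A \<omega> *v ?e)"
        by (rule norm_resolvent_le[OF bound]) simp
      also have "\<dots> \<le> K * (K * norm ?e)"
        using K \<omega> by (intro mult_left_mono norm_resolvent_le[OF bound]) auto
      finally show ?thesis .
    qed
    then have "\<omega> * ?v $ i \<le> \<omega> * K\<^sup>2"
      using \<omega>(1) by (simp add: norm_axis_1 power2_eq_square)
    ultimately show ?thesis
      using m[of i j] \<omega> by simp
  qed
  then show thesis
    using that \<omega>(1) by (simp add: nonneg_matrix_iff_axis)
qed

section \<open>The time stepping recursion\<close>

text \<open>Strong induction: the initial value enters with a partial sum of weights, an earlier
  value with the coefficient -w (n - j) >= 0, and the resolvent preserves signs.\<close>

lemma nonneg_discrete_solution:
  assumes nonneg: "nonneg_matrix (resolvent A (w 0))"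
    and neg: "\<And>j. 1 \<le> j \<Longrightarrow> w j \<le> 0" and partial: "\<And>n. 0 \<le> (\<Sum>j<n. w j)"
    and V: "\<And>i. 0 \<le> V $ i"
  shows "0 \<le> discrete_solution A w V n $ i"
proof (induction n arbitrary: i rule: less_induct)
  case (less n)
  show ?case
  proof (cases "n = 0")
    case True
    then show ?thesis
      using V by (simp add: discrete_solution.simps)
  next
    case False
    \<comment> \<open>For n > 0 the subtraction does not truncate, so this is the partial sum of
      exactly the first \<open>n\<close> weights.\<close>
    have "{0..n - 1} = {..<n}"
      using False by auto
    then have "0 \<le> (\<Sum>j=0..n - 1. w j) * V $ k" for k
      using partial V by simp
    moreover have "(\<Sum>j=1..n - 1. w (n - j) * discrete_solution A w V j $ k) \<le> 0" for k
      using False by (intro sum_nonpos mult_nonpos_nonneg neg less.IH) auto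
    ultimately have "0 \<le> ((\<Sum>j=0..n-1. w j *\<^sub>R V)
        - (\<Sum>j=1..n-1. w (n - j) *\<^sub>R discrete_solution A w V j)) $ k" for k
      by (simp add: sum_distrib_right del: One_nat_def) (meson order_trans)
    then show ?thesis
      using False
      by (subst discrete_solution.simps)
        (simp add: resolvent_def[symmetric] nonneg_matrix_mult_nonneg[OF nonneg])
  qed
qed

section \<open>Characteristic functions and weights\<close>

text \<open>The coefficients of the difference vanish one after another. This makes the definite
  description in \<open>weights\<close> unambiguous.\<close>

lemma power_series_unique:
  fixes v w :: "nat \<Rightarrow> real"
  assumes v: "\<And>\<xi>. \<bar>\<xi>\<bar> < 1 \<Longrightarrow> (\<lambda>j. v j * \<xi> ^ j) sums f \<xi>"
    and w: "\<And>\<xi>. \<bar>\<xi>\<bar> < 1 \<Longrightarrow> (\<lambda>j. w j * \<xi> ^ j) sums f \<xi>"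
  shows "v = w"
proof
  define u where "u = (\<lambda>j. v j - w j)"
  have u: "(\<lambda>j. u j * \<xi> ^ j) sums 0" if "\<bar>\<xi>\<bar> < 1" for \<xi>
    using sums_diff[OF v[OF that] w[OF that]] by (simp add: u_def algebra_simps)
  have "u n = 0" for n
  proof (induction n rule: less_induct)
    case (less n)
    \<comment> \<open>With the coefficients below \<open>n\<close> gone, the series can be divided
      by \<xi>^n. The excluded point \<xi> = 0 does not matter for the limit at 0, which is
      \<open>u n\<close>.\<close>
    have "(\<lambda>j. u (j + n) * \<xi> ^ j) sums 0" if "\<xi> \<noteq> 0" "norm \<xi> < 1" for \<xi>
    proof -
      have "(\<lambda>j. u (j + n) * \<xi> ^ (j + n)) sums (0 - (\<Sum>j<n. u j * \<xi> ^ j))"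
        using that by (intro sums_split_initial_segment u) simp
      moreover have "(\<Sum>j<n. u j * \<xi> ^ j) = 0"
        using less.IH by simp
      ultimately have "(\<lambda>j. u (j + n) * \<xi> ^ (j + n) / \<xi> ^ n) sums (0 / \<xi> ^ n)"
        by (intro sums_divide) simp
      then show ?thesis
        using that by (simp add: power_add)
    qed
    then have "((\<lambda>_. 0) \<longlongrightarrow> (\<lambda>j. u (j + n)) 0) (at (0 :: real))"
      by (rule powser_limit_0_strong[where a = "\<lambda>j. u (j + n)", OF zero_less_one])
    then show "u n = 0"
      by (simp add: tendsto_const_iff)
  qed
  then show "v n = w n" for n
    by (simp add: u_def)
qed

section \<open>Weights of a single power\<close>

text \<open>These are the coefficients of (1 - \<xi>)^\<alpha> beyond the constant term. They start
  at -\<alpha>, and the ratio of consecutive ones, (j + 1 - \<alpha>) / (j + 2), lies in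
  [0, 1].\<close>

lemma gbinomial_alternating_bounds:
  fixes \<alpha> :: real
  assumes "0 \<le> \<alpha>" "\<alpha> \<le> 1"
  shows "(-1) ^ Suc j * (\<alpha> gchoose Suc j) \<in> {-1..0}"
proof (induction j)
  case 0
  then show ?case using assms by simp
next
  case (Suc j)
  define c where "c = (-1) ^ Suc j * (\<alpha> gchoose Suc j)"
  define r where "r = (real (Suc j) - \<alpha>) / real (Suc (Suc j))"
  have "(\<alpha> gchoose Suc (Suc j)) = (\<alpha> - real (Suc j)) * (\<alpha> gchoose Suc j) / real (Suc (Suc j))"
    using gbinomial_mult_1[of \<alpha> "Suc j"] by (simp add: field_simps del: of_nat_Suc)
  then have "(-1) ^ Suc (Suc j) * (\<alpha> gchoose Suc (Suc j)) = r * c"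
    by (simp only: c_def r_def power_Suc)
      (simp add: right_diff_distrib diff_divide_distrib mult_ac del: of_nat_Suc)
  moreover have "0 \<le> r" "r \<le> 1"
    using assms by (auto simp: r_def field_simps)
  moreover have "-1 \<le> c" "c \<le> 0"
    using Suc.IH by (auto simp: c_def)
  ultimately show ?case
    using mult_mono[of r 1 "-c" 1] by (auto simp: mult_nonneg_nonpos)
qed

lemma gbinomial_abs_le_1:
  fixes \<alpha> :: real
  assumes "0 \<le> \<alpha>" "\<alpha> \<le> 1"
  shows "\<bar>\<alpha> gchoose j\<bar> \<le> 1"
proof (cases j)
  case (Suc k)
  have "\<bar>(-1) ^ Suc k * (\<alpha> gchoose Suc k)\<bar> \<le> 1"
    using gbinomial_alternating_bounds[OF assms, of k] by auto
  then show ?thesis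
    by (simp add: Suc abs_mult)
qed simp

text \<open>The convolution quadrature weight of the backward Euler method for a derivative of order
  \<alpha>. The exponent is the last argument because the weights are later integrated over
  it.\<close>

definition powr_weight :: "real \<Rightarrow> nat \<Rightarrow> real \<Rightarrow> real" where
  "powr_weight \<tau> j \<alpha> = (-1) ^ j * (\<alpha> gchoose j) * (1 / \<tau>) powr \<alpha>"

lemma powr_weight_sums:
  assumes "0 < \<tau>" "\<bar>\<xi>\<bar> < 1"
  shows "(\<lambda>j. powr_weight \<tau> j \<alpha> * \<xi> ^ j) sums ((1 - \<xi>) / \<tau>) powr \<alpha>"
proof -
  have "(\<lambda>j. (\<alpha> gchoose j) * (- \<xi>) ^ j * (1 / \<tau>) powr \<alpha>) sums ((1 + - \<xi>) powr \<alpha> * (1 / \<tau>) powr \<alpha>)"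
    using assms by (intro sums_mult2 gen_binomial_real) simp
  moreover have "(1 + - \<xi>) powr \<alpha> * (1 / \<tau>) powr \<alpha> = ((1 - \<xi>) / \<tau>) powr \<alpha>"
    using assms by (simp add: powr_mult[symmetric])
  moreover have "(\<alpha> gchoose j) * (- \<xi>) ^ j * (1 / \<tau>) powr \<alpha> = powr_weight \<tau> j \<alpha> * \<xi> ^ j" for j
    by (simp add: powr_weight_def power_minus[of \<xi>])
  ultimately show ?thesis
    by simp
qed

lemma powr_weight_nonpos:
  assumes "0 \<le> \<alpha>" "\<alpha> \<le> 1" "1 \<le> j"
  shows "powr_weight \<tau> j \<alpha> \<le> 0"
proof -
  obtain k where "j = Suc k"
    using assms(3) by (cases j) auto
  then show ?thesis
    using gbinomial_alternating_bounds[OF assms(1,2), of k]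
    by (auto simp: powr_weight_def intro!: mult_nonpos_nonneg)
qed

lemma continuous_on_powr_weight: "0 < \<tau> \<Longrightarrow> continuous_on S (powr_weight \<tau> j)"
  \<comment> \<open>In product form the binomial coefficient is visibly a polynomial in
    \<alpha>.\<close>
  unfolding powr_weight_def gbinomial_prod_rev by (intro continuous_intros) auto

section \<open>Existence of weights in the two cases\<close>

text \<open>As \<open>weights\<close> is a definite description, a sequence with the right
  generating function has to be exhibited first; its signs are recorded with it.\<close>

definition admissible_weights :: "(real \<Rightarrow> real) \<Rightarrow> real \<Rightarrow> (nat \<Rightarrow> real) \<Rightarrow> bool" where
  "admissible_weights P \<tau> w \<longleftrightarrow>
     (\<forall>\<xi>. \<bar>\<xi>\<bar> < 1 \<longrightarrow> (\<lambda>j. w j * \<xi> ^ j) sums P ((1 - \<xi>) / \<tau>)) \<and> (\<forall>j\<ge>1. w j \<le> 0)"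

lemma multi_term_exponents:
  assumes "0 < \<alpha> m" "\<forall>i. 1 \<le> i \<and> i < m \<longrightarrow> \<alpha> (Suc i) < \<alpha> i" "\<alpha> 1 < (1::real)" "1 \<le> i" "i \<le> m"
  shows "0 < \<alpha> i \<and> \<alpha> i < 1"
proof -
  have mono: "\<alpha> b \<le> \<alpha> a" if "1 \<le> a" "a \<le> b" "b \<le> m" for a b
    using that(2,3)
  proof (induction b rule: dec_induct)
    case (step n)
    then have "1 \<le> n \<and> n < m"
      using that(1) by simp
    then have "\<alpha> (Suc n) < \<alpha> n"
      using assms(2) by blast
    with step show ?case by simp
  qed simp
  show ?thesis
    using mono[of 1 i] mono[of i m] assms(1,3,4,5) by linarith
qed

lemma multi_term_char_funE:
  assumes "multi_term_char_fun P"
  obtains m \<alpha> b where "1 \<le> (m::nat)" "\<And>i. i \<in> {1..m} \<Longrightarrow> 0 < \<alpha> i \<and> \<alpha> i < 1"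
    "\<And>i. i \<in> {1..m} \<Longrightarrow> 0 < b i" "\<And>z. 0 < z \<Longrightarrow> P z = (\<Sum>i=1..m. b i * z powr \<alpha> i)"
proof -
  from assms obtain m \<alpha> b where *: "1 \<le> m" "0 < \<alpha> m" "\<forall>i. 1 \<le> i \<and> i < m \<longrightarrow> \<alpha> (Suc i) < \<alpha> i" "\<alpha> 1 < 1"
      "\<forall>i\<in>{1..m}. 0 < b i" "\<forall>z>0. P z = (\<Sum>i=1..m. b i * z powr \<alpha> i)"
    unfolding multi_term_char_fun_def by blast
  show thesis
  proof (rule that)
    show "0 < \<alpha> i \<and> \<alpha> i < 1" if "i \<in> {1..m}" for i
      using that by (intro multi_term_exponents[OF *(2-4)]) auto
  qed (use *(1,5,6) in simp_all)
qed

lemma multi_term_weights: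
  assumes "multi_term_char_fun P" "0 < \<tau>"
  shows "\<exists>w. admissible_weights P \<tau> w"
  using assms(1)
proof (rule multi_term_char_funE)
  fix m \<alpha> b
  assume \<alpha>: "\<And>i. i \<in> {1..m} \<Longrightarrow> 0 < \<alpha> i \<and> \<alpha> i < 1" and b: "\<And>i. i \<in> {1..m} \<Longrightarrow> 0 < b i"
    and P: "\<And>z. 0 < z \<Longrightarrow> P z = (\<Sum>i=1..m. b i * z powr \<alpha> i)"
  have "(\<lambda>j. (\<Sum>i=1..m. b i * powr_weight \<tau> j (\<alpha> i)) * \<xi> ^ j) sums P ((1 - \<xi>) / \<tau>)"
    if "\<bar>\<xi>\<bar> < 1" for \<xi>
  proof -
    have "(\<lambda>j. \<Sum>i=1..m. b i * (powr_weight \<tau> j (\<alpha> i) * \<xi> ^ j)) sums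
        (\<Sum>i=1..m. b i * ((1 - \<xi>) / \<tau>) powr \<alpha> i)"
      using assms(2) that by (intro sums_sum sums_mult powr_weight_sums)
    moreover have "P ((1 - \<xi>) / \<tau>) = (\<Sum>i=1..m. b i * ((1 - \<xi>) / \<tau>) powr \<alpha> i)"
      using assms(2) that by (intro P) simp
    ultimately show ?thesis
      by (simp add: sum_distrib_right mult.assoc)
  qed
  moreover have "(\<Sum>i=1..m. b i * powr_weight \<tau> j (\<alpha> i)) \<le> 0" if "1 \<le> j" for j
    using \<alpha> b that by (intro sum_nonpos mult_nonneg_nonpos powr_weight_nonpos) (auto intro: less_imp_le)
  ultimately show ?thesis
    unfolding admissible_weights_def
    by (intro exI[of _ "\<lambda>j. \<Sum>i=1..m. b i * powr_weight \<tau> j (\<alpha> i)"]) simp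
qed

lemma hoelder_continuous_on_imp_continuous_on:
  assumes "hoelder_continuous_on S f"
  shows "continuous_on S f"
proof -
  from assms obtain C \<gamma> where "0 < \<gamma>"
    and C: "\<forall>x\<in>S. \<forall>y\<in>S. \<bar>f x - f y\<bar> \<le> C * \<bar>x - y\<bar> powr \<gamma>"
    unfolding hoelder_continuous_on_def by blast
  have "(f \<longlongrightarrow> f x) (at x within S)" if "x \<in> S" for x
  proof -
    have "((\<lambda>y. C * \<bar>y - x\<bar> powr \<gamma>) \<longlongrightarrow> C * \<bar>x - x\<bar> powr \<gamma>) (at x within S)"
      using \<open>0 < \<gamma>\<close> by (intro tendsto_intros tendsto_powr') auto
    then have "((\<lambda>y. C * \<bar>y - x\<bar> powr \<gamma>) \<longlongrightarrow> 0) (at x within S)"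
      by simp
    moreover have "\<forall>\<^sub>F y in at x within S. norm (f y - f x) \<le> C * \<bar>y - x\<bar> powr \<gamma>"
      using C that by (auto simp: eventually_at_filter intro!: always_eventually)
    ultimately have "((\<lambda>y. f y - f x) \<longlongrightarrow> 0) (at x within S)"
      by (rule Lim_null_comparison[rotated])
    then show ?thesis
      by (simp add: LIM_zero_iff)
  qed
  then show ?thesis
    by (simp add: continuous_on_def)
qed

lemma distributed_char_funE:
  assumes "distributed_char_fun P"
  obtains \<mu> where "\<And>\<alpha>. \<alpha> \<in> {0..1} \<Longrightarrow> 0 \<le> \<mu> \<alpha>" "continuous_on {0..1} \<mu>" "0 < \<mu> 0"
    "\<And>z. 0 < z \<Longrightarrow> P z = integral {0..1} (\<lambda>\<alpha>. z powr \<alpha> * \<mu> \<alpha>)"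
proof -
  from assms obtain \<mu> where *: "\<forall>\<alpha>\<in>{0..1}. 0 \<le> \<mu> \<alpha>" "hoelder_continuous_on {0..1} \<mu>" "0 < \<mu> 0 * \<mu> 1"
      "\<forall>z>0. P z = integral {0..1} (\<lambda>\<alpha>. z powr \<alpha> * \<mu> \<alpha>)"
    unfolding distributed_char_fun_def by blast
  show thesis
  proof (rule that)
    have "0 \<le> \<mu> 0" "0 \<le> \<mu> 1"
      using *(1) by auto
    then show "0 < \<mu> 0"
      using *(3) by (auto simp: zero_less_mult_iff)
    show "continuous_on {0..1} \<mu>"
      using *(2) by (rule hoelder_continuous_on_imp_continuous_on)
  qed (use *(1,4) in simp_all)
qed

text \<open>The single-power weights are integrated against \<mu>. Sum and integral may be
  interchanged because the series converges uniformly in \<alpha>: the binomial coefficients are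
  bounded by 1 and |\<xi>| < 1.\<close>

lemma distributed_weights:
  assumes "distributed_char_fun P" "0 < \<tau>"
  shows "\<exists>w. admissible_weights P \<tau> w"
  using assms(1)
proof (rule distributed_char_funE)
  fix \<mu>
  assume nonneg: "\<And>\<alpha>. \<alpha> \<in> {0..1} \<Longrightarrow> 0 \<le> \<mu> \<alpha>" and cont: "continuous_on {0..1} \<mu>"
    and P: "\<And>z. 0 < z \<Longrightarrow> P z = integral {0..1} (\<lambda>\<alpha>. z powr \<alpha> * \<mu> \<alpha>)"
  define w where "w = (\<lambda>j. integral {0..1} (\<lambda>\<alpha>. powr_weight \<tau> j \<alpha> * \<mu> \<alpha>))"
  have cont_w: "continuous_on {0..1} (\<lambda>\<alpha>. powr_weight \<tau> j \<alpha> * \<mu> \<alpha>)" for j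
    using assms(2) cont by (intro continuous_on_mult continuous_on_powr_weight)
  then have int: "(\<lambda>\<alpha>. powr_weight \<tau> j \<alpha> * \<mu> \<alpha>) integrable_on {0..1}" for j
    by (rule integrable_continuous_interval)
  \<comment> \<open>Compactness bounds the factor that does not depend on \<open>j\<close>; the
    bound \<open>B\<close> becomes the constant of the geometric majorant.\<close>
  have "compact ((\<lambda>\<alpha>. (1 / \<tau>) powr \<alpha> * \<mu> \<alpha>) ` {0..1})"
    using assms(2) cont by (intro compact_continuous_image continuous_intros) auto
  then have "bounded ((\<lambda>\<alpha>. (1 / \<tau>) powr \<alpha> * \<mu> \<alpha>) ` {0..1})"
    by (rule compact_imp_bounded)
  then obtain B where B: "\<And>\<alpha>. \<alpha> \<in> {0..1} \<Longrightarrow> norm ((1 / \<tau>) powr \<alpha> * \<mu> \<alpha>) \<le> B"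
    unfolding bounded_iff by blast
  have "(\<lambda>j. w j * \<xi> ^ j) sums P ((1 - \<xi>) / \<tau>)" if \<xi>: "\<bar>\<xi>\<bar> < 1" for \<xi>
  proof -
    let ?f = "\<lambda>n \<alpha>. \<Sum>j<n. powr_weight \<tau> j \<alpha> * \<mu> \<alpha> * \<xi> ^ j"
    have "uniform_limit {0..1} ?f (\<lambda>\<alpha>. \<Sum>j. powr_weight \<tau> j \<alpha> * \<mu> \<alpha> * \<xi> ^ j) sequentially"
    proof (rule Weierstrass_m_test)
      show "summable (\<lambda>j. B * \<bar>\<xi>\<bar> ^ j)"
        using \<xi> by (intro summable_mult summable_geometric) simp
      fix j and \<alpha> :: real
      assume \<alpha>: "\<alpha> \<in> {0..1}"
      have "norm (powr_weight \<tau> j \<alpha> * \<mu> \<alpha> * \<xi> ^ j) =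
          \<bar>\<alpha> gchoose j\<bar> * norm ((1 / \<tau>) powr \<alpha> * \<mu> \<alpha>) * \<bar>\<xi>\<bar> ^ j"
        by (simp add: powr_weight_def abs_mult power_abs)
      also have "\<dots> \<le> 1 * B * \<bar>\<xi>\<bar> ^ j"
        using \<alpha> B[OF \<alpha>] by (intro mult_right_mono mult_mono gbinomial_abs_le_1) auto
      finally show "norm (powr_weight \<tau> j \<alpha> * \<mu> \<alpha> * \<xi> ^ j) \<le> B * \<bar>\<xi>\<bar> ^ j"
        by simp
    qed
    moreover have "(\<Sum>j. powr_weight \<tau> j \<alpha> * \<mu> \<alpha> * \<xi> ^ j) = ((1 - \<xi>) / \<tau>) powr \<alpha> * \<mu> \<alpha>" for \<alpha>
      using sums_mult2[OF powr_weight_sums[OF assms(2) \<xi>], of \<alpha> "\<mu> \<alpha>"]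
      by (simp add: sums_iff mult.commute mult.left_commute)
    ultimately have "uniform_limit {0..1} ?f (\<lambda>\<alpha>. ((1 - \<xi>) / \<tau>) powr \<alpha> * \<mu> \<alpha>) sequentially"
      by simp
    moreover have "continuous_on {0..1} (?f n)" for n
      by (intro continuous_on_sum continuous_on_mult_right cont_w)
    ultimately obtain I J where I: "\<And>n. (?f n has_integral I n) {0..1}"
      and J: "((\<lambda>\<alpha>. ((1 - \<xi>) / \<tau>) powr \<alpha> * \<mu> \<alpha>) has_integral J) {0..1}" and IJ: "I \<longlonglongrightarrow> J"
      by (rule uniform_limit_integral) auto
    have "I = (\<lambda>n. \<Sum>j<n. w j * \<xi> ^ j)"
    proof (rule ext, rule has_integral_unique[OF I])
      show "(?f n has_integral (\<Sum>j<n. w j * \<xi> ^ j)) {0..1}" for n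
        unfolding w_def using int
        by (intro has_integral_sum has_integral_mult_left integrable_integral) auto
    qed
    moreover have "J = P ((1 - \<xi>) / \<tau>)"
      using P[of "(1 - \<xi>) / \<tau>"] J \<xi> assms(2) by (simp add: integral_unique)
    ultimately show ?thesis
      using IJ by (simp add: sums_def)
  qed
  moreover have "w j \<le> 0" if "1 \<le> j" for j
    unfolding w_def using int nonneg that
    by (intro integral_le[of _ _ "\<lambda>_. 0", simplified] mult_nonpos_nonneg powr_weight_nonpos) auto
  ultimately show ?thesis
    unfolding admissible_weights_def by blast
qed


section \<open>Positivity, monotonicity and decay of the characteristic function\<close>

lemma char_fun_pos_mono:
  assumes "multi_term_char_fun P \<or> distributed_char_fun P"
  shows "0 < z \<Longrightarrow> 0 < P z" "0 < z \<Longrightarrow> z \<le> y \<Longrightarrow> P z \<le> P y"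
proof -
  have "0 < P z \<and> (z \<le> y \<longrightarrow> P z \<le> P y)" if "0 < z" for z y
    using assms
  proof
    assume "multi_term_char_fun P"
    then show ?thesis
    proof (rule multi_term_char_funE)
      fix m \<alpha> b
      assume m: "1 \<le> (m::nat)" and \<alpha>: "\<And>i. i \<in> {1..m} \<Longrightarrow> 0 < \<alpha> i \<and> \<alpha> i < 1"
        and b: "\<And>i. i \<in> {1..m} \<Longrightarrow> 0 < b i"
        and P: "\<And>z. 0 < z \<Longrightarrow> P z = (\<Sum>i=1..m. b i * z powr \<alpha> i)"
      have "0 < (\<Sum>i=1..m. b i * z powr \<alpha> i)"
        using m b that by (intro sum_pos mult_pos_pos) auto
      moreover have "(\<Sum>i=1..m. b i * z powr \<alpha> i) \<le> (\<Sum>i=1..m. b i * y powr \<alpha> i)" if "z \<le> y"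
        using \<alpha> b \<open>0 < z\<close> that
        by (intro sum_mono mult_left_mono powr_mono2) (auto intro: less_imp_le)
      ultimately show ?thesis
        using that by (simp add: P)
    qed
  next
    assume "distributed_char_fun P"
    then show ?thesis
    proof (rule distributed_char_funE)
      fix \<mu>
      assume nonneg: "\<And>\<alpha>. \<alpha> \<in> {0..1} \<Longrightarrow> 0 \<le> \<mu> \<alpha>" and cont: "continuous_on {0..1} \<mu>"
        and \<mu>0: "0 < \<mu> 0" and P: "\<And>z. 0 < z \<Longrightarrow> P z = integral {0..1} (\<lambda>\<alpha>. z powr \<alpha> * \<mu> \<alpha>)"
      have cont_z: "continuous_on {0..1} (\<lambda>\<alpha>. z powr \<alpha> * \<mu> \<alpha>)" if "0 < z" for z
        using that cont by (intro continuous_intros) auto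
      \<comment> \<open>A continuous nonnegative integrand with integral zero vanishes everywhere,
        but at \<alpha> = 0 this one equals \<mu> 0 > 0.\<close>
      have "integral {0..1} (\<lambda>\<alpha>. z powr \<alpha> * \<mu> \<alpha>) \<noteq> 0"
        using integral_eq_0_iff[OF cont_z[OF \<open>0 < z\<close>]] nonneg \<mu>0 that by force
      moreover have "0 \<le> integral {0..1} (\<lambda>\<alpha>. z powr \<alpha> * \<mu> \<alpha>)"
        using nonneg by (intro integral_nonneg integrable_continuous_interval cont_z that) auto
      moreover have "integral {0..1} (\<lambda>\<alpha>. z powr \<alpha> * \<mu> \<alpha>) \<le> integral {0..1} (\<lambda>\<alpha>. y powr \<alpha> * \<mu> \<alpha>)"
        if "z \<le> y"
        using that \<open>0 < z\<close> nonneg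
        by (intro integral_le integrable_continuous_interval cont_z mult_right_mono powr_mono2) auto
      ultimately show ?thesis
        using that by (simp add: P)
    qed
  qed
  then show "0 < z \<Longrightarrow> 0 < P z" "0 < z \<Longrightarrow> z \<le> y \<Longrightarrow> P z \<le> P y"
    by blast+
qed

text \<open>A sequence of arguments suffices: by monotonicity of \<open>P\<close>, one time step
  with a small value of \<open>P\<close> settles all larger ones.\<close>

lemma char_fun_tendsto_0:
  assumes "multi_term_char_fun P \<or> distributed_char_fun P"
  shows "(\<lambda>n. P (1 / real (Suc n))) \<longlonglongrightarrow> 0"
  using assms
proof
  assume "multi_term_char_fun P"
  then show ?thesis
  proof (rule multi_term_char_funE)
    fix m \<alpha> b
    assume \<alpha>: "\<And>i. i \<in> {1..m} \<Longrightarrow> 0 < \<alpha> i \<and> \<alpha> i < 1"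
      and P: "\<And>z. 0 < z \<Longrightarrow> P z = (\<Sum>i=1..(m::nat). b i * z powr \<alpha> i)"
    have "(\<lambda>n. \<Sum>i=1..m. b i * (1 / real (Suc n)) powr \<alpha> i) \<longlonglongrightarrow> (\<Sum>i=1..m. b i * 0 powr \<alpha> i)"
      using \<alpha> lim_1_over_n[THEN LIMSEQ_Suc]
      by (intro tendsto_sum tendsto_mult tendsto_const tendsto_powr') auto
    then show ?thesis
      by (simp add: P)
  qed
next
  assume "distributed_char_fun P"
  then show ?thesis
  proof (rule distributed_char_funE)
    fix \<mu>
    assume cont: "continuous_on {0..1} \<mu>"
      and P: "\<And>z. 0 < z \<Longrightarrow> P z = integral {0..1} (\<lambda>\<alpha>. z powr \<alpha> * \<mu> \<alpha>)"
    \<comment> \<open>The pointwise limit. At \<alpha> = 0 the power stays 1, so \<mu> 0 survives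
      there, but a single point does not affect the integral.\<close>
    let ?g = "\<lambda>\<alpha>::real. if \<alpha> = 0 then \<mu> 0 else 0"
    have "(\<lambda>n. integral {0..1} (\<lambda>\<alpha>. (1 / real (Suc n)) powr \<alpha> * \<mu> \<alpha>)) \<longlonglongrightarrow> integral {0..1} ?g"
    proof (rule dominated_convergence)
      show "(\<lambda>\<alpha>. (1 / real (Suc n)) powr \<alpha> * \<mu> \<alpha>) integrable_on {0..1}" for n
        using cont by (intro integrable_continuous_interval continuous_intros) auto
      show "(\<lambda>\<alpha>. \<bar>\<mu> \<alpha>\<bar>) integrable_on {0..1}"
        using cont by (intro integrable_continuous_interval continuous_intros)
      show "norm ((1 / real (Suc n)) powr \<alpha> * \<mu> \<alpha>) \<le> \<bar>\<mu> \<alpha>\<bar>" if "\<alpha> \<in> {0..1}" for n \<alpha>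
      proof -
        have "(1 / real (Suc n)) powr \<alpha> \<le> 1"
          using that by (intro powr_le1) auto
        then show ?thesis
          by (simp add: abs_mult mult_left_le_one_le)
      qed
      show "(\<lambda>n. (1 / real (Suc n)) powr \<alpha> * \<mu> \<alpha>) \<longlonglongrightarrow> ?g \<alpha>" if "\<alpha> \<in> {0..1}" for \<alpha>
      proof (cases "\<alpha> = 0")
        case False
        have "(\<lambda>n. (1 / real (Suc n)) powr \<alpha> * \<mu> \<alpha>) \<longlonglongrightarrow> 0 powr \<alpha> * \<mu> \<alpha>"
          using False that lim_1_over_n[THEN LIMSEQ_Suc]
          by (intro tendsto_mult tendsto_const tendsto_powr') auto
        then show ?thesis
          using False by simp
      qed simp
    qed
    moreover have "integral {0..1} ?g = integral {0..1} (\<lambda>_ :: real. 0)"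
      by (rule integral_spike[of "{0}"]) auto
    ultimately show ?thesis
      by (simp add: P)
  qed
qed

text \<open>Existence comes from the two cases, uniqueness from the identity theorem for power
  series, so the description denotes the sequence constructed above.\<close>

lemma weights_admissible:
  assumes "multi_term_char_fun P \<or> distributed_char_fun P" "0 < \<tau>"
  shows "admissible_weights P \<tau> (weights P \<tau>)"
proof -
  obtain w where w: "admissible_weights P \<tau> w"
    using assms multi_term_weights distributed_weights by blast
  have "weights P \<tau> = w"
    unfolding weights_def
  proof (rule the_equality)
    show "v = w" if "\<forall>\<xi>. \<bar>\<xi>\<bar> < 1 \<longrightarrow> (\<lambda>j. v j * \<xi> ^ j) sums P ((1 - \<xi>) / \<tau>)" for v
      using that w unfolding admissible_weights_def
      by (intro power_series_unique[of v "\<lambda>\<xi>. P ((1 - \<xi>) / \<tau>)" w]) blast+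
  qed (use w in \<open>simp add: admissible_weights_def\<close>)
  then show ?thesis
    using w by simp
qed

lemma weights_0:
  assumes "multi_term_char_fun P \<or> distributed_char_fun P" "0 < \<tau>"
  shows "weights P \<tau> 0 = P (1 / \<tau>)"
proof -
  \<comment> \<open>At \<xi> = 0 only the term j = 0 remains, as 0 ^ 0 = 1.\<close>
  have "(\<lambda>j. weights P \<tau> j * 0 ^ j) sums P ((1 - 0) / \<tau>)"
    using weights_admissible[OF assms] unfolding admissible_weights_def by (metis abs_zero zero_less_one)
  then show ?thesis
    by simp
qed

text \<open>For \<open>0 < \<xi> < 1\<close> the truncated series dominates the full sum \<open>P ((1 - \<xi>) / \<tau>) > 0\<close>, because
  the omitted terms are nonpositive. Now let \<open>\<xi>\<close> tend to 1.\<close>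

lemma weights_partial_sums_nonneg:
  assumes P: "multi_term_char_fun P \<or> distributed_char_fun P" and "0 < \<tau>"
  shows "0 \<le> (\<Sum>j<n. weights P \<tau> j)"
proof (cases "n = 0")
  case False
  let ?s = "\<lambda>\<xi>. \<Sum>j<n. weights P \<tau> j * \<xi> ^ j"
  have adm: "admissible_weights P \<tau> (weights P \<tau>)"
    using assms by (rule weights_admissible)
  have "0 \<le> ?s \<xi>" if \<xi>: "0 < \<xi>" "\<xi> < 1" for \<xi>
  proof -
    have sums: "(\<lambda>j. weights P \<tau> j * \<xi> ^ j) sums P ((1 - \<xi>) / \<tau>)"
      using adm \<xi> unfolding admissible_weights_def by auto
    have tail: "(\<lambda>j. weights P \<tau> (j + n) * \<xi> ^ (j + n)) sums (P ((1 - \<xi>) / \<tau>) - ?s \<xi>)"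
      using sums by (rule sums_split_initial_segment)
    \<comment> \<open>Since n >= 1, the positive weight of index 0 is not in the tail.\<close>
    have "weights P \<tau> (j + n) * \<xi> ^ (j + n) \<le> 0" for j
      using adm \<xi> False unfolding admissible_weights_def by (intro mult_nonpos_nonneg) auto
    from sums_le[OF this tail sums_zero] have "P ((1 - \<xi>) / \<tau>) \<le> ?s \<xi>"
      by simp
    moreover have "0 < P ((1 - \<xi>) / \<tau>)"
      using \<xi> \<open>0 < \<tau>\<close> by (intro char_fun_pos_mono[OF P]) simp
    ultimately show ?thesis
      by linarith
  qed
  then have "\<forall>\<^sub>F \<xi> in at_left 1. 0 \<le> ?s \<xi>"
    by (intro eventually_at_leftI[of 0]) auto
  moreover have "(?s \<longlongrightarrow> ?s 1) (at_left 1)"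
    by (intro tendsto_intros)
  ultimately have "0 \<le> ?s 1"
    by (intro tendsto_lowerbound) auto
  then show ?thesis
    by simp
qed simp

section \<open>Positive definiteness of the mass and stiffness matrices\<close>

text \<open>Near an interior point of \<open>K\<close> the function coincides with an affine one,
  and gradients are unique, so the definite description in \<open>grad\<close> picks
  \<open>a\<close>.\<close>

lemma grad_affine:
  assumes v: "\<And>y. y \<in> K \<Longrightarrow> v y = a \<bullet> y + c" and x: "x \<in> interior K"
  shows "grad v x = a"
proof -
  have "((\<lambda>y. a \<bullet> y + c) has_derivative (\<lambda>h. h \<bullet> a)) (at x)"
    by (auto intro!: derivative_eq_intros simp: inner_commute)
  then have "(v has_derivative (\<lambda>h. h \<bullet> a)) (at x)"
    by (rule has_derivative_transform_within_open[OF _ open_interior x])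
      (use v subsetD[OF interior_subset, of _ K] in simp)
  then have deriv: "GDERIV v x :> a"
    by (simp add: gderiv_def)
  have "D = a" if "GDERIV v x :> D" for D
  proof -
    have "(\<lambda>h. h \<bullet> D) = (\<lambda>h. h \<bullet> a)"
      using that deriv unfolding gderiv_def by (rule has_derivative_unique)
    from fun_cong[OF this, of "D - a"] have "(D - a) \<bullet> (D - a) = 0"
      by (simp add: inner_diff_right)
    then show ?thesis
      by simp
  qed
  with deriv show ?thesis
    unfolding grad_def by (rule the_equality)
qed

text \<open>A simplex of full dimension affinely spans the space, so its interior is its relative
  interior, which is nonempty for a nonempty convex set.\<close>

lemma interior_simplex_nonempty:
  fixes K :: "'a::euclidean_space set"
  assumes "int DIM('a) simplex K"
  shows "interior K \<noteq> {}"
proof -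
  have "affine hull K = UNIV"
    using aff_dim_simplex[OF assms] by (simp add: aff_dim_eq_full)
  then have "interior K = rel_interior K"
    by (simp add: rel_interior_interior)
  moreover have "K \<noteq> {}"
    using assms by auto
  ultimately show ?thesis
    using convex_simplex[OF assms] by (simp add: rel_interior_eq_empty)
qed

section \<open>Null sets and integrability on the mesh\<close>

lemma negligible_frontier_polygonal_domain:
  assumes "bounded_polygonal_domain \<Omega>"
  shows "negligible (frontier \<Omega>)"
proof -
  from assms obtain S where S: "finite S" "frontier \<Omega> = (\<Union>(a, b)\<in>S. closed_segment a b)"
    unfolding bounded_polygonal_domain_def by blast
  have "negligible (closed_segment a b)" for a b :: "real^2"
    by (simp add: negligible_convex_interior interior_closed_segment_ge2)
  then show ?thesis
    using S by (auto intro!: negligible_Union)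
qed

lemma triangulation_of_cell:
  assumes "triangulation_of \<Omega> \<T>" "K \<in> \<T>"
  shows "convex K" "K \<subseteq> closure \<Omega>" "interior K \<noteq> {}"
proof -
  have K: "2 simplex K" "\<Union>\<T> = closure \<Omega>"
    using assms unfolding triangulation_of_def by blast+
  then show "convex K" "K \<subseteq> closure \<Omega>" "interior K \<noteq> {}"
    using assms(2) convex_simplex interior_simplex_nonempty[of K] by auto
qed

lemma triangulation_of_finite: "triangulation_of \<Omega> \<T> \<Longrightarrow> finite \<T>"
  by (simp add: triangulation_of_def triangulation_def)

text \<open>A triangle is given only as a subset of the closure of \<Omega>. The part of its
  interior outside \<Omega> lies in the frontier, a null set, whereas a nonempty open set is not
  null.\<close>

lemma triangulation_of_not_negligible:
  assumes \<Omega>: "bounded_polygonal_domain \<Omega>" and \<T>: "triangulation_of \<Omega> \<T>" and K: "K \<in> \<T>"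
  shows "\<not> negligible (interior K \<inter> \<Omega>)"
proof
  assume "negligible (interior K \<inter> \<Omega>)"
  moreover have "interior K \<subseteq> (interior K \<inter> \<Omega>) \<union> frontier \<Omega>"
    using triangulation_of_cell(2)[OF \<T> K] interior_subset[of K] interior_subset[of \<Omega>]
    unfolding frontier_def by blast
  ultimately have "negligible (interior K)"
    using negligible_frontier_polygonal_domain[OF \<Omega>] by (metis negligible_Un negligible_subset)
  then show False
    using open_not_negligible triangulation_of_cell(3)[OF \<T> K] by blast
qed

text \<open>Meant for products of gradients, whose values on the mesh edges are unspecified. The
  edges form a null set, so these values are harmless.\<close>

lemma set_integrable_piecewise_constant:
  fixes f :: "real^2 \<Rightarrow> real"
  assumes \<Omega>: "bounded_polygonal_domain \<Omega>" and \<T>: "triangulation_of \<Omega> \<T>"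
    and const: "\<And>K. K \<in> \<T> \<Longrightarrow> \<exists>d. \<forall>x\<in>interior K. f x = d"
  shows "set_integrable lebesgue \<Omega> f"
proof -
  let ?W = "\<Union>K\<in>\<T>. interior K \<inter> \<Omega>"
  have "open \<Omega>" "bounded \<Omega>"
    using \<Omega> by (auto simp: bounded_polygonal_domain_def)
  then have meas: "interior K \<inter> \<Omega> \<in> lmeasurable" for K :: "(real^2) set"
    by (intro lmeasurable_open) (auto intro: bounded_subset)
  have "set_integrable lebesgue ?W f"
  proof (rule set_integrable_UN)
    show "finite \<T>"
      by (rule triangulation_of_finite[OF \<T>])
    show "interior K \<inter> \<Omega> \<in> sets lebesgue" for K
      using meas by (rule fmeasurableD)
    fix K assume "K \<in> \<T>"
    then obtain d where d: "\<forall>x\<in>interior K. f x = d"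
      using const by blast
    have "set_integrable lebesgue (interior K \<inter> \<Omega>) (\<lambda>_. d)"
      using meas by (rule absolutely_integrable_on_const)
    then show "set_integrable lebesgue (interior K \<inter> \<Omega>) f"
      by (rule absolutely_integrable_spike[OF _ negligible_empty]) (use d in auto)
  qed
  \<comment> \<open>Every point of \<Omega> lies in some triangle; if it misses all the interiors,
    it is on the frontier of one, and frontiers of convex sets are null sets.\<close>
  moreover have "negligible (\<Union>K\<in>\<T>. frontier K)"
    using triangulation_of_finite[OF \<T>] triangulation_of_cell(1)[OF \<T>]
    by (auto intro!: negligible_Union negligible_convex_frontier)
  then have "negligible {x \<in> \<Omega> - ?W. f x \<noteq> 0}"
  proof (rule negligible_subset)
    have "\<Omega> \<subseteq> \<Union>\<T>"
      using \<T> closure_subset unfolding triangulation_of_def by auto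
    show "{x \<in> \<Omega> - ?W. f x \<noteq> 0} \<subseteq> (\<Union>K\<in>\<T>. frontier K)"
    proof
      fix x assume x: "x \<in> {x \<in> \<Omega> - ?W. f x \<noteq> 0}"
      then obtain K where K: "K \<in> \<T>" "x \<in> K"
        using \<open>\<Omega> \<subseteq> \<Union>\<T>\<close> by auto
      then have "x \<notin> interior K"
        using x by auto
      then have "x \<in> frontier K"
        using K closure_subset[of K] by (auto simp: frontier_def)
      then show "x \<in> (\<Union>K\<in>\<T>. frontier K)"
        using K by auto
    qed
  qed
  moreover have "{x \<in> ?W - \<Omega>. f x \<noteq> 0} = {}"
    by auto
  ultimately show ?thesis
    using absolutely_integrable_spike_set_eq[of ?W \<Omega> f] by simp
qed

text \<open>A continuous function with finitely many values on the connected set \<Omega> is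
  constant, and its zero boundary values determine the constant.\<close>

lemma fe_space_const_imp_zero:
  assumes \<Omega>: "bounded_polygonal_domain \<Omega>" and \<T>: "triangulation_of \<Omega> \<T>"
    and v: "v \<in> fe_space \<Omega> \<T>"
    and const: "\<And>K. K \<in> \<T> \<Longrightarrow> \<exists>d. \<forall>x\<in>K. v x = d"
  shows "v x = 0"
proof (cases "x \<in> \<Omega>")
  case True
  have dom: "\<Omega> \<noteq> {}" "open \<Omega>" "connected \<Omega>" "bounded \<Omega>"
    using \<Omega> by (auto simp: bounded_polygonal_domain_def)
  have cont: "continuous_on (closure \<Omega>) v" and out: "\<And>x. x \<notin> \<Omega> \<Longrightarrow> v x = 0"
    using v by (auto simp: fe_space_def)
  obtain d where d: "\<And>K x. K \<in> \<T> \<Longrightarrow> x \<in> K \<Longrightarrow> v x = d K"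
    using const by metis
  have "\<Omega> \<subseteq> \<Union>\<T>"
    using \<T> closure_subset unfolding triangulation_of_def by auto
  then have "v ` \<Omega> \<subseteq> d ` \<T>"
    using d by blast
  then have "finite (v ` \<Omega>)"
    using triangulation_of_finite[OF \<T>] finite_surj by blast
  then have "v constant_on \<Omega>"
    by (intro continuous_finite_range_constant dom continuous_on_subset[OF cont closure_subset])
  then obtain e where e: "\<And>x. x \<in> \<Omega> \<Longrightarrow> v x = e"
    by (auto simp: constant_on_def)
  \<comment> \<open>Boundedness enters here: it guarantees a frontier point.\<close>
  have "\<Omega> \<noteq> UNIV"
    using dom(4) by auto
  then obtain y where y: "y \<in> frontier \<Omega>"
    using dom(1) frontier_eq_empty by blast
  then have "y \<in> closure \<Omega>"
    by (simp add: frontier_def)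
  then have "v y = e"
    by (simp add: continuous_constant_on_closure[OF cont e])
  moreover have "v y = 0"
    using y dom(2) by (intro out) (simp add: frontier_def interior_open)
  ultimately show ?thesis
    using e True by simp
qed (use v in \<open>simp add: fe_space_def\<close>)

lemma fe_space_sum:
  assumes "\<And>i. i \<in> I \<Longrightarrow> u i \<in> fe_space \<Omega> \<T>"
  shows "(\<lambda>x. \<Sum>i\<in>I. c i * u i x) \<in> fe_space \<Omega> \<T>"
proof -
  have "\<exists>a d. \<forall>x\<in>K. (\<Sum>i\<in>I. c i * u i x) = a \<bullet> x + d" if "K \<in> \<T>" for K
  proof -
    have "\<forall>i\<in>I. \<exists>a d. \<forall>x\<in>K. u i x = a \<bullet> x + d"
      using assms that by (simp add: fe_space_def)
    then obtain a d where "\<And>i x. i \<in> I \<Longrightarrow> x \<in> K \<Longrightarrow> u i x = a i \<bullet> x + d i"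
      by metis
    then show ?thesis
      by (intro exI[of _ "\<Sum>i\<in>I. c i *\<^sub>R a i"] exI[of _ "\<Sum>i\<in>I. c i * d i"])
        (simp add: inner_sum_left sum.distrib[symmetric] distrib_left)
  qed
  then show ?thesis
    using assms by (auto simp: fe_space_def intro!: continuous_intros sum.neutral)
qed

section \<open>The quadratic forms of the two matrices\<close>

lemma quadratic_form_sum:
  fixes A :: "real^'n^'n"
  shows "x \<bullet> (A *v x) = (\<Sum>i\<in>UNIV. \<Sum>j\<in>UNIV. x $ i * x $ j * A $ i $ j)"
  by (simp add: inner_vec_def matrix_vector_mult_def sum_distrib_left mult_ac)

lemma nodal_combination_eq_0:
  fixes x :: "real^'n"
  assumes "nodal_basis \<Omega> \<T> p \<phi>" "\<And>y. (\<Sum>i\<in>UNIV. x $ i * \<phi> i y) = 0"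
  shows "x = 0"
proof -
  have delta: "\<phi> i (p j) = (if i = j then 1 else 0)" for i j
    using assms(1) by (simp add: nodal_basis_def)
  have "(\<Sum>i\<in>UNIV. x $ i * \<phi> i (p j)) = x $ j" for j
    by (simp add: delta if_distrib cong: if_cong)
  then show ?thesis
    using assms(2) by (simp add: vec_eq_iff)
qed

text \<open>The quadratic form is the Dirichlet energy of the combination of the \<phi> i with
  coefficients \<open>x\<close>. Zero energy makes this function constant on each triangle, hence
  zero, and its nodal values are the entries of \<open>x\<close>.\<close>

lemma stiffness_matrix_pos_def:
  fixes x :: "real^'n"
  assumes \<Omega>: "bounded_polygonal_domain \<Omega>" and \<T>: "triangulation_of \<Omega> \<T>"
    and \<phi>: "nodal_basis \<Omega> \<T> p \<phi>" and "x \<noteq> 0"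
  shows "0 < x \<bullet> (stiffness_matrix \<Omega> \<phi> *v x)"
proof -
  \<comment> \<open>The combination of the gradients, not the gradient of the combination: the
    expansion of G.G then holds at every point, also where \<open>grad\<close> is
    unspecified.\<close>
  define G where "G = (\<lambda>y. \<Sum>i\<in>UNIV. x $ i *\<^sub>R grad (\<phi> i) y)"
  have \<phi>_fe: "\<phi> i \<in> fe_space \<Omega> \<T>" for i
    using \<phi> by (simp add: nodal_basis_def)
  have "\<forall>K\<in>\<T>. \<forall>i. \<exists>a c. \<forall>y\<in>K. \<phi> i y = a \<bullet> y + c"
    using \<phi>_fe by (simp add: fe_space_def)
  then obtain a c where ac: "\<And>K i y. K \<in> \<T> \<Longrightarrow> y \<in> K \<Longrightarrow> \<phi> i y = a K i \<bullet> y + c K i"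
    by metis
  then have grad: "grad (\<phi> i) y = a K i" if "K \<in> \<T>" "y \<in> interior K" for K i y
    using that by (intro grad_affine) auto
  have int: "set_integrable lebesgue \<Omega> (\<lambda>y. grad (\<phi> j) y \<bullet> grad (\<phi> i) y)" for i j
    using grad by (intro set_integrable_piecewise_constant[OF \<Omega> \<T>]) auto
  have GG: "G y \<bullet> G y = (\<Sum>i\<in>UNIV. \<Sum>j\<in>UNIV. x $ i * x $ j * (grad (\<phi> j) y \<bullet> grad (\<phi> i) y))" for y
    by (simp add: G_def inner_sum_left inner_sum_right sum_distrib_left mult_ac)
  have int_G: "set_integrable lebesgue \<Omega> (\<lambda>y. G y \<bullet> G y)"
    unfolding GG using int unfolding set_integrable_def
    by (simp add: sum_distrib_left mult.left_commute[of "indicator _ _"])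
  have "x \<bullet> (stiffness_matrix \<Omega> \<phi> *v x) = (LINT y:\<Omega>|lebesgue. G y \<bullet> G y)"
    unfolding quadratic_form_sum stiffness_matrix_def GG using int
    unfolding set_lebesgue_integral_def set_integrable_def
    by (simp add: sum_distrib_left mult.left_commute[of "indicator _ _"])
  moreover have "0 \<le> (LINT y:\<Omega>|lebesgue. G y \<bullet> G y)"
    unfolding set_lebesgue_integral_def by (intro Bochner_Integration.integral_nonneg) simp
  moreover have "(LINT y:\<Omega>|lebesgue. G y \<bullet> G y) \<noteq> 0"
  proof
    assume "(LINT y:\<Omega>|lebesgue. G y \<bullet> G y) = 0"
    then have ae: "AE y in lebesgue. indicator \<Omega> y *\<^sub>R (G y \<bullet> G y) = 0"
      using integral_nonneg_eq_0_iff_AE[OF int_G[unfolded set_integrable_def]]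
      by (simp add: set_lebesgue_integral_def)
    \<comment> \<open>\<open>G\<close> is constant inside a triangle and zero almost everywhere in
      \<Omega>; a nonzero constant would make the part of that interior in \<Omega> a null
      set.\<close>
    have zero: "(\<Sum>i\<in>UNIV. x $ i *\<^sub>R a K i) = 0" if K: "K \<in> \<T>" for K
    proof (rule ccontr)
      assume nz: "(\<Sum>i\<in>UNIV. x $ i *\<^sub>R a K i) \<noteq> 0"
      have "G y = (\<Sum>i\<in>UNIV. x $ i *\<^sub>R a K i)" if "y \<in> interior K" for y
        using grad[OF K that] by (simp add: G_def)
      with ae nz have "AE y in lebesgue. y \<notin> interior K \<inter> \<Omega>"
        by (auto elim!: eventually_mono)
      moreover have "open (interior K \<inter> \<Omega>)"
        using \<Omega> by (auto simp: bounded_polygonal_domain_def)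
      ultimately have "negligible (interior K \<inter> \<Omega>)"
        by (simp add: negligible_iff_null_sets AE_iff_null_sets)
      then show False
        using triangulation_of_not_negligible[OF \<Omega> \<T> K] by contradiction
    qed
    have "(\<Sum>i\<in>UNIV. x $ i * \<phi> i y) = (\<Sum>i\<in>UNIV. x $ i * c K i)" if "K \<in> \<T>" "y \<in> K" for K y
    proof -
      have "(\<Sum>i\<in>UNIV. x $ i * \<phi> i y) = (\<Sum>i\<in>UNIV. x $ i *\<^sub>R a K i) \<bullet> y + (\<Sum>i\<in>UNIV. x $ i * c K i)"
        using ac[OF that] by (simp add: inner_sum_left sum.distrib distrib_left)
      then show ?thesis
        using zero[OF that(1)] by simp
    qed
    then have "(\<Sum>i\<in>UNIV. x $ i * \<phi> i y) = 0" for y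
      by (intro fe_space_const_imp_zero[OF \<Omega> \<T> fe_space_sum] \<phi>_fe) blast
    then show False
      using nodal_combination_eq_0[OF \<phi>] \<open>x \<noteq> 0\<close> by blast
  qed
  ultimately show ?thesis
    by linarith
qed

lemma inner_product_on_sum:
  assumes ip: "inner_product_on (fe_space \<Omega> \<T>) ip" and "finite I"
    and "\<And>i. i \<in> I \<Longrightarrow> u i \<in> fe_space \<Omega> \<T>" and w: "w \<in> fe_space \<Omega> \<T>"
  shows "ip (\<lambda>x. \<Sum>i\<in>I. c i * u i x) w = (\<Sum>i\<in>I. c i * ip (u i) w)"
  using assms(2,3)
proof (induction I rule: finite_induct)
  case empty
  \<comment> \<open>The empty sum is the zero function, written as 0 times \<open>w\<close> so that
    homogeneity applies.\<close>
  have "ip (\<lambda>x. 0 * w x) w = 0 * ip w w"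
    using ip w unfolding inner_product_on_def by blast
  then show ?case
    by simp
next
  case (insert i I)
  have add: "ip (\<lambda>x. f x + g x) w = ip f w + ip g w" if "f \<in> fe_space \<Omega> \<T>" "g \<in> fe_space \<Omega> \<T>" for f g
    using ip w that unfolding inner_product_on_def by blast
  have "ip (\<lambda>x. c i * u i x + (\<Sum>i\<in>I. c i * u i x)) w =
      ip (\<lambda>x. c i * u i x) w + ip (\<lambda>x. \<Sum>i\<in>I. c i * u i x) w"
    using fe_space_sum[of "{i}" u] fe_space_sum[of I u] insert.prems by (intro add) auto
  moreover have "ip (\<lambda>x. c i * u i x) w = c i * ip (u i) w"
    using ip w insert.prems unfolding inner_product_on_def by blast
  ultimately show ?case
    using insert by simp
qed

text \<open>The quadratic form is \<open>ip v v\<close> for the function \<open>v\<close> with nodal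
  values \<open>x\<close>, and \<open>v\<close> is nonzero because \<open>x\<close> is.\<close>

lemma mass_matrix_pos_def:
  fixes x :: "real^'n"
  assumes \<phi>: "nodal_basis \<Omega> \<T> p \<phi>" and ip: "inner_product_on (fe_space \<Omega> \<T>) ip" and "x \<noteq> 0"
  shows "0 < x \<bullet> (mass_matrix ip \<phi> *v x)"
proof -
  define v where "v = (\<lambda>y. \<Sum>i\<in>UNIV. x $ i * \<phi> i y)"
  have \<phi>_fe: "\<phi> i \<in> fe_space \<Omega> \<T>" for i
    using \<phi> by (simp add: nodal_basis_def)
  then have v: "v \<in> fe_space \<Omega> \<T>"
    unfolding v_def by (rule fe_space_sum)
  have ip_v: "ip v w = (\<Sum>j\<in>UNIV. x $ j * ip (\<phi> j) w)" if "w \<in> fe_space \<Omega> \<T>" for w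
    unfolding v_def using \<phi>_fe that by (intro inner_product_on_sum[OF ip]) auto
  have "ip v v = (\<Sum>i\<in>UNIV. x $ i * ip v (\<phi> i))"
    using ip v \<phi>_fe ip_v[OF v] unfolding inner_product_on_def by simp
  also have "\<dots> = x \<bullet> (mass_matrix ip \<phi> *v x)"
    by (simp add: quadratic_form_sum mass_matrix_def ip_v[OF \<phi>_fe] sum_distrib_left mult_ac)
  finally have "x \<bullet> (mass_matrix ip \<phi> *v x) = ip v v"
    by simp
  moreover have "v \<noteq> (\<lambda>_. 0)"
    using nodal_combination_eq_0[OF \<phi>, of x] \<open>x \<noteq> 0\<close> unfolding v_def by metis
  ultimately show ?thesis
    using ip v unfolding inner_product_on_def by simp
qed

section \<open>Nonnegativity of the solution matrices\<close>

text \<open>Common core of both claims, which differ only in the source of \<omega>: a small value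
  obtained from the positive inverse, or P (1 / \<tau>0). From \<omega> nonnegativity descends to
  the leading weight P (1 / \<tau>).\<close>

lemma nonneg_solution_matrix:
  assumes P: "multi_term_char_fun P \<or> distributed_char_fun P" and bound: "resolvent_bound A K"
    and nonneg: "nonneg_matrix (resolvent A \<omega>)" and \<tau>: "0 < \<tau>" "P (1 / \<tau>) \<le> \<omega>"
  shows "nonneg_matrix (solution_matrix P A n \<tau>)"
proof -
  have "0 < P (1 / \<tau>)"
    using \<tau> by (intro char_fun_pos_mono[OF P]) simp
  then have "nonneg_matrix (resolvent A (weights P \<tau> 0))"
    using nonneg_resolvent_antimono[OF bound nonneg] \<tau> weights_0[OF P] by simp
  moreover have "weights P \<tau> j \<le> 0" if "1 \<le> j" for j
    using weights_admissible[OF P \<tau>(1)] that by (simp add: admissible_weights_def)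
  ultimately have "0 \<le> discrete_solution A (weights P \<tau>) (axis j 1) n $ i" for i j
    using weights_partial_sums_nonneg[OF P \<tau>(1)]
    by (intro nonneg_discrete_solution) (auto simp: axis_def)
  then show ?thesis
    by (simp add: nonneg_matrix_iff_axis solution_matrix_works)
qed

theorem theorem4p2:
  fixes P :: "real \<Rightarrow> real"
    and \<Omega> :: "(real^2) set"
    and \<T> :: "(real^2) set set"
    and p :: "'n::finite \<Rightarrow> real^2"
    and \<phi> :: "'n \<Rightarrow> real^2 \<Rightarrow> real"
    and ip :: "(real^2 \<Rightarrow> real) \<Rightarrow> (real^2 \<Rightarrow> real) \<Rightarrow> real"
  assumes "multi_term_char_fun P \<or> distributed_char_fun P"
    and "bounded_polygonal_domain \<Omega>"
    and "triangulation_of \<Omega> \<T>"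
    and "bij_betw p UNIV (interior_nodes \<Omega> \<T>)"
    and "nodal_basis \<Omega> \<T> p \<phi>"
    and "inner_product_on (fe_space \<Omega> \<T>) ip"
  shows "(pos_matrix (matrix_inv (fe_operator \<Omega> ip \<phi>)) \<longrightarrow>
            (\<exists>\<tau>0>0. \<forall>\<tau>\<ge>\<tau>0. \<forall>n\<ge>1.
               nonneg_matrix (solution_matrix P (fe_operator \<Omega> ip \<phi>) n \<tau>))) \<and>
         (\<forall>\<tau>0>0. nonneg_matrix (solution_matrix P (fe_operator \<Omega> ip \<phi>) 1 \<tau>0) \<longrightarrow>
            (\<forall>\<tau>\<ge>\<tau>0. \<forall>n\<ge>1.
               nonneg_matrix (solution_matrix P (fe_operator \<Omega> ip \<phi>) n \<tau>)) \<and>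
            nonneg_matrix (matrix_inv (fe_operator \<Omega> ip \<phi>)))"
proof -
  define A where "A = fe_operator \<Omega> ip \<phi>"
  note P = assms(1)
  obtain K where K: "resolvent_bound A K"
    unfolding A_def fe_operator_def
    using resolvent_bound_pos_def mass_matrix_pos_def[OF assms(5,6)]
      stiffness_matrix_pos_def[OF assms(2,3,5)] by blast
  have inv: "matrix_inv A = resolvent A 0"
    by (simp add: resolvent_def)
  have "\<exists>\<tau>0>0. \<forall>\<tau>\<ge>\<tau>0. \<forall>n\<ge>1. nonneg_matrix (solution_matrix P A n \<tau>)"
    if "pos_matrix (matrix_inv A)"
  proof -
    obtain \<omega> where \<omega>: "0 < \<omega>" "nonneg_matrix (resolvent A \<omega>)"
      using nonneg_resolvent_near_0[OF K] \<open>pos_matrix (matrix_inv A)\<close> unfolding inv by blast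
    have "\<forall>\<^sub>F n in sequentially. P (1 / real (Suc n)) < \<omega>"
      using char_fun_tendsto_0[OF P] \<omega>(1) by (rule order_tendstoD(2))
    \<comment> \<open>The threshold is \<tau>0 = m + 1; monotonicity of \<open>P\<close> covers all
      larger time steps.\<close>
    then obtain m where m: "P (1 / real (Suc m)) < \<omega>"
      by (meson eventually_sequentially order_refl)
    have "nonneg_matrix (solution_matrix P A n \<tau>)" if "real (Suc m) \<le> \<tau>" for n \<tau>
    proof -
      have "0 < \<tau>"
        using that by (rule less_le_trans[rotated]) simp
      moreover from this have "P (1 / \<tau>) \<le> P (1 / real (Suc m))"
        using that by (intro char_fun_pos_mono[OF P] divide_left_mono) auto
      ultimately show ?thesis
        using m by (intro nonneg_solution_matrix[OF P K \<omega>(2)]) auto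
    qed
    then show ?thesis
      by (intro exI[of _ "real (Suc m)"]) simp
  qed
  moreover have "(\<forall>\<tau>\<ge>\<tau>0. \<forall>n\<ge>1. nonneg_matrix (solution_matrix P A n \<tau>)) \<and>
      nonneg_matrix (matrix_inv A)"
    if "0 < \<tau>0" "nonneg_matrix (solution_matrix P A 1 \<tau>0)" for \<tau>0
  proof -
    have pos: "0 < P (1 / \<tau>0)"
      using that(1) by (intro char_fun_pos_mono[OF P]) simp
    \<comment> \<open>A positive multiple of a resolvent, so the hypothesis on the first step is
      exactly nonnegativity of the resolvent at P (1 / \<tau>0).\<close>
    have "solution_matrix P A 1 \<tau>0 = P (1 / \<tau>0) *\<^sub>R resolvent A (P (1 / \<tau>0))"
      unfolding solution_matrix_1 weights_0[OF P that(1)] resolvent_def ..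
    then have nonneg: "nonneg_matrix (resolvent A (P (1 / \<tau>0)))"
      using that(2) pos by (auto simp: nonneg_matrix_def zero_le_mult_iff)
    have "nonneg_matrix (solution_matrix P A n \<tau>)" if "\<tau>0 \<le> \<tau>" for n \<tau>
      using \<open>0 < \<tau>0\<close> that
      by (intro nonneg_solution_matrix[OF P K nonneg] char_fun_pos_mono[OF P] divide_left_mono) auto
    moreover have "nonneg_matrix (resolvent A 0)"
      using nonneg_resolvent_antimono[OF K nonneg] pos by simp
    ultimately show ?thesis
      by (simp add: inv)
  qed
  ultimately show ?thesis
    unfolding A_def by blast
qed

end
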